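(* With $Q,g,\eta,V,L,\mathcal D,\mathbb FL,H,H_c$ as in the context, for every $q\in Q$ and every $\beta_q\in\mathbb{F}L(\mathcal D)_q=\mathbb FL(\mathcal D_q)$ one has $dH(\beta_q)=d(H_c\circ i_{\mathcal D}^* )(\beta_q)$.
   Context: $Q$ is a smooth manifold with Riemannian metric $g$, $1$-form $\eta$ and $V\in C^\infty(Q)$; $L(v_q)=\tfrac12g_q(v_q,v_q)+\langle\eta(q),v_q\rangle-V(q)$. $\mathcal D\subset TQ$ is a smooth distribution of constant rank $r\ge2$, $\mathcal D^\perp$ its $g$-orthogonal complement, $i_{\mathcal D}:\mathcal D\hookrightarrow TQ$ the inclusion. $\mathcal D^*$ is identified with $\flat_g(\mathcal D)\subset T^*Q$ and $(\mathcal D^\perp)^*$ with $\mathcal D^\circ$, so $T^*Q=\mathcal D^*\oplus(\mathcal D^\perp)^*$, and $i_{\mathcal D}^*:T^*Q\to\mathcal D^*$ is the projection along $(\mathcal D^\perp)^*$. $\mathbb FL:TQ\to T^*Q$ is the fibre derivative of $L$ (equal to $\flat_g+\eta\circ\tau_Q$), $E_L(v_q)=\tfrac12 g(v_q,v_q)+V(q)$, $H=E_L\circ(\mathbb FL)^{-1}$; $\mathbb FL_c:\mathcal D\to\mathcal D^*$ is the fibre derivative of $L\circ i_{\mathcal D}$, and $H_c=(E_L\circ i_{\mathcal D})\circ(\mathbb FL_c)^{-1}\in C^\infty(\mathcal D^* )$. *)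

theory Defs
  imports "HOL-Analysis.Analysis"
begin

text \<open>Local-coordinate model. The configuration manifold Q is modelled by an open
  set U of the Euclidean space real^'n (a chart domain); TQ and T*Q are U x real^'n,
  a covector p acting on a vector v by the inner product p \<bullet> v.\<close>

text \<open>C^k and C^infinity maps on an open set (iterated Frechet derivatives).\<close>
fun Ck_on :: "nat \<Rightarrow> 'a::real_normed_vector set \<Rightarrow> ('a \<Rightarrow> 'b::real_normed_vector) \<Rightarrow> bool" where
  "Ck_on 0 S f = continuous_on S f"
| "Ck_on (Suc k) S f =
     ((\<forall>x\<in>S. f differentiable (at x)) \<and>
      (\<forall>v. Ck_on k S (\<lambda>x. frechet_derivative f (at x) v)))"

definition smooth_on :: "'a::real_normed_vector set \<Rightarrow> ('a \<Rightarrow> 'b::real_normed_vector) \<Rightarrow> bool" where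
  "smooth_on S f \<longleftrightarrow> (\<forall>k. Ck_on k S f)"

text \<open>Riemannian metric on U, given by its Gram matrix field.\<close>
definition riemannian_metric :: "(real^'n) set \<Rightarrow> (real^'n \<Rightarrow> real^'n^'n) \<Rightarrow> bool" where
  "riemannian_metric U g \<longleftrightarrow>
     smooth_on U g \<and>
     (\<forall>q\<in>U. transpose (g q) = g q \<and> (\<forall>v. v \<noteq> 0 \<longrightarrow> v \<bullet> (g q *v v) > 0))"

text \<open>Smooth distribution of constant rank r: each fibre is an r-dimensional subspace,
  and locally D is spanned by r smooth vector fields.\<close>
definition smooth_distribution :: "(real^'n) set \<Rightarrow> (real^'n \<Rightarrow> (real^'n) set) \<Rightarrow> nat \<Rightarrow> bool" where
  "smooth_distribution U D r \<longleftrightarrow>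
     (\<forall>q\<in>U. subspace (D q) \<and> dim (D q) = r) \<and>
     (\<forall>q\<in>U. \<exists>W. open W \<and> q \<in> W \<and> W \<subseteq> U \<and>
        (\<exists>X :: nat \<Rightarrow> real^'n \<Rightarrow> real^'n.
           (\<forall>i<r. smooth_on W (X i)) \<and>
           (\<forall>x\<in>W. D x = span ((\<lambda>i. X i x) ` {..<r}))))"

text \<open>Lagrangian L(v_q) = 1/2 g(v,v) + <eta(q),v> - V(q).\<close>
definition lagr :: "(real^'n \<Rightarrow> real^'n^'n) \<Rightarrow> (real^'n \<Rightarrow> real^'n) \<Rightarrow> (real^'n \<Rightarrow> real)
    \<Rightarrow> (real^'n) \<times> (real^'n) \<Rightarrow> real" where
  "lagr g eta V = (\<lambda>(q, v). (1/2) * (v \<bullet> (g q *v v)) + eta q \<bullet> v - V q)"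

text \<open>Energy E_L(v_q) = 1/2 g(v,v) + V(q).\<close>
definition energy :: "(real^'n \<Rightarrow> real^'n^'n) \<Rightarrow> (real^'n \<Rightarrow> real) \<Rightarrow> (real^'n) \<times> (real^'n) \<Rightarrow> real" where
  "energy g V = (\<lambda>(q, v). (1/2) * (v \<bullet> (g q *v v)) + V q)"

text \<open>Fibre derivative FL = flat_g + eta o tau_Q.\<close>
definition legendre :: "(real^'n \<Rightarrow> real^'n^'n) \<Rightarrow> (real^'n \<Rightarrow> real^'n)
    \<Rightarrow> (real^'n) \<times> (real^'n) \<Rightarrow> (real^'n) \<times> (real^'n)" where
  "legendre g eta = (\<lambda>(q, v). (q, g q *v v + eta q))"

text \<open>H = E_L o (FL)^{-1} on T*Q = U x real^'n.\<close>
definition hamiltonian :: "(real^'n) set \<Rightarrow> (real^'n \<Rightarrow> real^'n^'n) \<Rightarrow> (real^'n \<Rightarrow> real^'n)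
    \<Rightarrow> (real^'n \<Rightarrow> real) \<Rightarrow> (real^'n) \<times> (real^'n) \<Rightarrow> real" where
  "hamiltonian U g eta V = energy g V \<circ> the_inv_into (U \<times> UNIV) (legendre g eta)"

text \<open>The total space of D, of D^* = flat_g(D) and the annihilator D^circ = (D^perp)^*.\<close>
definition dbundle :: "(real^'n) set \<Rightarrow> (real^'n \<Rightarrow> (real^'n) set) \<Rightarrow> ((real^'n) \<times> (real^'n)) set" where
  "dbundle U D = {(q, v). q \<in> U \<and> v \<in> D q}"

definition dstar_fib :: "(real^'n \<Rightarrow> real^'n^'n) \<Rightarrow> (real^'n \<Rightarrow> (real^'n) set) \<Rightarrow> real^'n \<Rightarrow> (real^'n) set" where
  "dstar_fib g D q = (\<lambda>v. g q *v v) ` D q"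

definition dstar_bundle :: "(real^'n) set \<Rightarrow> (real^'n \<Rightarrow> real^'n^'n) \<Rightarrow> (real^'n \<Rightarrow> (real^'n) set)
    \<Rightarrow> ((real^'n) \<times> (real^'n)) set" where
  "dstar_bundle U g D = {(q, a). q \<in> U \<and> a \<in> dstar_fib g D q}"

definition annih :: "(real^'n \<Rightarrow> (real^'n) set) \<Rightarrow> real^'n \<Rightarrow> (real^'n) set" where
  "annih D q = {p. \<forall>v\<in>D q. p \<bullet> v = 0}"

text \<open>i_D^*: projection of T*Q onto D^* along D^circ.\<close>
definition iDstar :: "(real^'n \<Rightarrow> real^'n^'n) \<Rightarrow> (real^'n \<Rightarrow> (real^'n) set)
    \<Rightarrow> (real^'n) \<times> (real^'n) \<Rightarrow> (real^'n) \<times> (real^'n)" where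
  "iDstar g D = (\<lambda>(q, p). (q, THE a. a \<in> dstar_fib g D q \<and> p - a \<in> annih D q))"

text \<open>FL_c: fibre derivative of L o i_D, the functional w |-> d/dt L(v + t w) at t = 0
  on D_q, represented by its (unique) representative in D^*_q = flat_g(D_q).\<close>
definition legendre_c :: "(real^'n \<Rightarrow> real^'n^'n) \<Rightarrow> (real^'n \<Rightarrow> real^'n) \<Rightarrow> (real^'n \<Rightarrow> real)
    \<Rightarrow> (real^'n \<Rightarrow> (real^'n) set) \<Rightarrow> (real^'n) \<times> (real^'n) \<Rightarrow> (real^'n) \<times> (real^'n)" where
  "legendre_c g eta V D = (\<lambda>(q, v). (q, THE a. a \<in> dstar_fib g D q \<and>
      (\<forall>w\<in>D q. ((\<lambda>t. lagr g eta V (q, v + t *\<^sub>R w)) has_real_derivative (a \<bullet> w)) (at 0))))"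

text \<open>H_c = (E_L o i_D) o (FL_c)^{-1} on D^*.\<close>
definition hamiltonian_c :: "(real^'n) set \<Rightarrow> (real^'n \<Rightarrow> real^'n^'n) \<Rightarrow> (real^'n \<Rightarrow> real^'n)
    \<Rightarrow> (real^'n \<Rightarrow> real) \<Rightarrow> (real^'n \<Rightarrow> (real^'n) set) \<Rightarrow> (real^'n) \<times> (real^'n) \<Rightarrow> real" where
  "hamiltonian_c U g eta V D =
     energy g V \<circ> the_inv_into (dbundle U D) (legendre_c g eta V D)"

end

theory Submission
  imports Defs
begin

text \<open>In the chart, write G = g(y) and let b be the velocity with FL(y, b) = (y, p), so that
  H(y, p) = 1/2 b.Gb + V(y). Since FL_c = i_D^* o FL on D, one finds
  (H_c o i_D^*)(y, p) = 1/2 c.Gc + V(y), where c is the G-orthogonal projection of b onto D_y.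
  By Pythagoras the gap H - H_c o i_D^* lies between 0 and 1/2 |b - w|_G^2 for every w in D_y.
  Taking for w a local section of D through v, this upper bound is a quadratic form in a
  differentiable function vanishing at FL(q, v), so it has derivative zero there; hence so has
  the gap, and H and H_c o i_D^* have the same derivative at FL(q, v).\<close>

lemma inner_matrix_vector_mult_symmetric:
  fixes G :: "real^'n^'n"
  assumes "transpose G = G"
  shows "x \<bullet> (G *v y) = (G *v x) \<bullet> y"
  using assms by (metis dot_lmul_matrix transpose_matrix_vector)

lemma bounded_bilinear_matrix_vector_mult:
  "bounded_bilinear (\<lambda>(A::real^'n^'m) (x::real^'n). A *v x)"
proof -
  have "bilinear (\<lambda>(A::real^'n^'m) (x::real^'n). A *v x)"
    unfolding bilinear_def
    by (auto intro!: linearI simp: matrix_vector_mult_add_rdistrib scaleR_matrix_vector_assoc)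
  then show ?thesis
    by (simp add: bilinear_conv_bounded_bilinear)
qed

lemma positive_definite_matrix_injective:
  fixes G :: "real^'n^'n"
  assumes "\<And>v. v \<noteq> 0 \<Longrightarrow> v \<bullet> (G *v v) > 0"
  shows "inj ((*v) G)"
proof -
  have "G *v x = 0 \<Longrightarrow> x = 0" for x
    using assms[of x] by (metis inner_zero_right less_irrefl)
  then show ?thesis
    using linear_injective_0[of "(*v) G"] by auto
qed

lemma image_inter_annihilator_eq_0:
  fixes G :: "real^'n^'n"
  assumes pd: "\<And>v. v \<noteq> 0 \<Longrightarrow> v \<bullet> (G *v v) > 0" and S: "subspace S"
  shows "(*v) G ` S \<inter> {p. \<forall>v\<in>S. p \<bullet> v = 0} = {0}"
proof -
  have "a = 0" if "a \<in> (*v) G ` S" and annihilates: "\<forall>v\<in>S. a \<bullet> v = 0" for a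
  proof -
    obtain w where w: "w \<in> S" "a = G *v w"
      using \<open>a \<in> (*v) G ` S\<close> by blast
    then have "w \<bullet> (G *v w) = 0"
      using annihilates by (simp add: inner_commute)
    then have "w = 0"
      using pd[of w] by force
    then show "a = 0"
      using w by simp
  qed
  moreover have "0 \<in> (*v) G ` S"
    using subspace_0[OF S] by (metis image_eqI matrix_vector_mult_0_right)
  ultimately show ?thesis
    by auto
qed

lemma image_plus_annihilator_eq_UNIV:
  fixes G :: "real^'n^'n"
  assumes pd: "\<And>v. v \<noteq> 0 \<Longrightarrow> v \<bullet> (G *v v) > 0" and S: "subspace S"
  shows "{x + y |x y. x \<in> (*v) G ` S \<and> y \<in> {p. \<forall>v\<in>S. p \<bullet> v = 0}} = UNIV"
proof -
  define GS where "GS = (*v) G ` S"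
  define A where "A = {p. \<forall>v\<in>S. p \<bullet> v = 0}"
  have A_orth: "A = {y. \<forall>x\<in>S. orthogonal x y}"
    unfolding A_def orthogonal_def by (auto simp: inner_commute)
  have GS: "subspace GS"
    unfolding GS_def by (intro linear_subspace_image S) simp
  have A: "subspace A"
    unfolding A_orth by (simp add: subspace_orthogonal_to_vectors)
  have "dim GS = dim S"
    unfolding GS_def using positive_definite_matrix_injective[OF pd] S
    by (intro dim_image_eq) (auto simp: inj_on_def inj_def)
  moreover have "dim A + dim S = DIM(real^'n)"
    unfolding A_orth using dim_subspace_orthogonal_to_vectors[OF S subspace_UNIV] by simp
  moreover have "GS \<inter> A = {0}"
    unfolding GS_def A_def by (rule image_inter_annihilator_eq_0[OF pd S])
  ultimately have "dim {x + y |x y. x \<in> GS \<and> y \<in> A} = DIM(real^'n)"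
    using dim_sums_Int[OF GS A] by simp
  then have "span {x + y |x y. x \<in> GS \<and> y \<in> A} = UNIV"
    using dim_eq_full by blast
  moreover have "span {x + y |x y. x \<in> GS \<and> y \<in> A} = {x + y |x y. x \<in> GS \<and> y \<in> A}"
    using subspace_sums[OF GS A] by (rule span_eq_iff[THEN iffD2])
  ultimately show ?thesis
    unfolding GS_def A_def by simp
qed

lemma image_annihilator_decomposition:
  fixes G :: "real^'n^'n"
  assumes pd: "\<And>v. v \<noteq> 0 \<Longrightarrow> v \<bullet> (G *v v) > 0" and S: "subspace S"
  shows "\<exists>!a. a \<in> (*v) G ` S \<and> p - a \<in> {p. \<forall>v\<in>S. p \<bullet> v = 0}"
proof -
  define GS where "GS = (*v) G ` S"
  define A where "A = {p. \<forall>v\<in>S. p \<bullet> v = 0}"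
  have GS: "subspace GS"
    unfolding GS_def by (intro linear_subspace_image S) simp
  have A: "subspace A"
    unfolding A_def subspace_def by (simp add: inner_add_left)
  have "p \<in> {x + y |x y. x \<in> (*v) G ` S \<and> y \<in> {p. \<forall>v\<in>S. p \<bullet> v = 0}}"
    using image_plus_annihilator_eq_UNIV[OF pd S] by blast
  then obtain a n where a: "a \<in> GS" "n \<in> A" "p = a + n"
    unfolding GS_def A_def by blast
  show ?thesis
    unfolding GS_def[symmetric] A_def[symmetric]
  proof (rule ex1I[of _ a])
    show "a \<in> GS \<and> p - a \<in> A"
      using a by simp
  next
    fix b assume b: "b \<in> GS \<and> p - b \<in> A"
    have "p - a \<in> A"
      using a by simp
    then have "(p - b) - (p - a) \<in> A"
      by (rule subspace_diff[OF A conjunct2[OF b]])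
    then have "a - b \<in> A"
      by simp
    moreover have "a - b \<in> GS"
      by (rule subspace_diff[OF GS a(1) conjunct1[OF b]])
    ultimately have "a - b \<in> GS \<inter> A"
      by (rule IntI[rotated])
    also have "GS \<inter> A = {0}"
      unfolding GS_def A_def by (rule image_inter_annihilator_eq_0[OF pd S])
    finally show "b = a"
      by simp
  qed
qed

lemma exists_orthogonal_projection:
  fixes G :: "real^'n^'n"
  assumes pd: "\<And>v. v \<noteq> 0 \<Longrightarrow> v \<bullet> (G *v v) > 0" and S: "subspace S"
  obtains c where "c \<in> S" and "\<forall>x\<in>S. (G *v (b - c)) \<bullet> x = 0"
proof -
  obtain a where a: "a \<in> (*v) G ` S" "G *v b - a \<in> {p. \<forall>v\<in>S. p \<bullet> v = 0}"
    using ex1_implies_ex[OF image_annihilator_decomposition[OF pd S, of "G *v b"]] by blast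
  then obtain c where "c \<in> S" "a = G *v c"
    by blast
  with a(2) show ?thesis
    by (intro that) (simp_all add: matrix_vector_mult_diff_distrib)
qed

lemma quadratic_form_pythagoras:
  fixes G :: "real^'n^'n"
  assumes sym: "transpose G = G" and orth: "(G *v m) \<bullet> z = 0"
  shows "(m + z) \<bullet> (G *v (m + z)) = m \<bullet> (G *v m) + z \<bullet> (G *v z)"
proof -
  have "m \<bullet> (G *v z) = 0" "z \<bullet> (G *v m) = 0"
    using orth inner_matrix_vector_mult_symmetric[OF sym, of m z] by (simp_all add: inner_commute)
  then show ?thesis
    by (simp add: matrix_vector_right_distrib inner_add_left inner_add_right)
qed

lemma orthogonal_projection_quadratic_form_bounds:
  fixes G :: "real^'n^'n"
  assumes sym: "transpose G = G" and psd: "\<And>x. 0 \<le> x \<bullet> (G *v x)"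
    and S: "subspace S" and c: "c \<in> S" and w: "w \<in> S"
    and orth: "\<forall>x\<in>S. (G *v (b - c)) \<bullet> x = 0"
  shows "0 \<le> b \<bullet> (G *v b) - c \<bullet> (G *v c)"
    and "b \<bullet> (G *v b) - c \<bullet> (G *v c) \<le> (b - w) \<bullet> (G *v (b - w))"
proof -
  have pythagoras: "(b - z) \<bullet> (G *v (b - z)) = (b - c) \<bullet> (G *v (b - c)) + (c - z) \<bullet> (G *v (c - z))"
    if "z \<in> S" for z
    using quadratic_form_pythagoras[OF sym, of "b - c" "c - z"] orth subspace_diff[OF S c that]
    by simp
  have gap: "b \<bullet> (G *v b) - c \<bullet> (G *v c) = (b - c) \<bullet> (G *v (b - c))"
    using pythagoras[OF subspace_0[OF S]] by simp
  show "0 \<le> b \<bullet> (G *v b) - c \<bullet> (G *v c)"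
    unfolding gap by (rule psd)
  show "b \<bullet> (G *v b) - c \<bullet> (G *v c) \<le> (b - w) \<bullet> (G *v (b - w))"
    unfolding gap pythagoras[OF w] using psd[of "c - w"] by simp
qed

lemma riemannian_metricD:
  assumes "riemannian_metric U g" and "y \<in> U"
  shows riemannian_metric_symmetric: "transpose (g y) = g y"
    and riemannian_metric_positive: "v \<noteq> 0 \<Longrightarrow> v \<bullet> (g y *v v) > 0"
    and riemannian_metric_nonneg: "0 \<le> v \<bullet> (g y *v v)"
proof -
  have metric: "transpose (g y) = g y \<and> (\<forall>v. v \<noteq> 0 \<longrightarrow> v \<bullet> (g y *v v) > 0)"
    using assms unfolding riemannian_metric_def by blast
  then show "transpose (g y) = g y" and "v \<noteq> 0 \<Longrightarrow> v \<bullet> (g y *v v) > 0"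
    by simp_all
  show "0 \<le> v \<bullet> (g y *v v)"
    using metric by (cases "v = 0") (simp_all add: less_imp_le)
qed

lemma riemannian_metric_smooth: "riemannian_metric U g \<Longrightarrow> smooth_on U g"
  unfolding riemannian_metric_def by blast

lemma subspace_annih: "subspace (annih D y)"
  unfolding annih_def subspace_def by (simp add: inner_add_left)

lemma iDstar_eq_iff:
  assumes "riemannian_metric U g" and "y \<in> U" and "subspace (D y)"
  shows "iDstar g D (y, p) = (y, a) \<longleftrightarrow> a \<in> dstar_fib g D y \<and> p - a \<in> annih D y"
proof -
  let ?P = "\<lambda>a. a \<in> dstar_fib g D y \<and> p - a \<in> annih D y"
  have unique: "\<exists>!a. ?P a"
    unfolding dstar_fib_def annih_def
    by (rule image_annihilator_decomposition[OF riemannian_metric_positive[OF assms(1,2)] assms(3)])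
  have "(THE a. ?P a) = a \<longleftrightarrow> ?P a"
  proof
    assume "(THE a. ?P a) = a"
    then show "?P a"
      using theI'[OF unique] by simp
  next
    assume "?P a"
    then show "(THE a. ?P a) = a"
      by (rule the1_equality[OF unique])
  qed
  then show ?thesis
    by (simp add: iDstar_def)
qed

lemma iDstar_eq_if_annih:
  assumes "riemannian_metric U g" and "y \<in> U" and "subspace (D y)"
    and "p - p' \<in> annih D y"
  shows "iDstar g D (y, p) = iDstar g D (y, p')"
proof -
  obtain a where a: "iDstar g D (y, p') = (y, a)"
    by (simp add: iDstar_def)
  then have a_fib: "a \<in> dstar_fib g D y" and a_annih: "p' - a \<in> annih D y"
    using iDstar_eq_iff[where D = D, OF assms(1-3)] by blast+
  have "(p - p') + (p' - a) \<in> annih D y"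
    by (rule subspace_add[OF subspace_annih assms(4) a_annih])
  then have "p - a \<in> annih D y"
    by simp
  with a_fib show ?thesis
    unfolding a using iDstar_eq_iff[where D = D, OF assms(1-3)] by blast
qed

lemma lagr_has_real_derivative_along_line:
  assumes sym: "transpose (g q) = g q"
  shows "((\<lambda>t. lagr g eta V (q, v + t *\<^sub>R w)) has_real_derivative ((g q *v v + eta q) \<bullet> w)) (at 0)"
proof -
  define G where "G = g q"
  have expand: "lagr g eta V (q, v + t *\<^sub>R w) =
      lagr g eta V (q, v) + t * ((G *v v + eta q) \<bullet> w) + t\<^sup>2 * ((1/2) * (w \<bullet> (G *v w)))" for t
  proof -
    have "(v + t *\<^sub>R w) \<bullet> (G *v (v + t *\<^sub>R w)) =
        v \<bullet> (G *v v) + 2 * t * ((G *v v) \<bullet> w) + t\<^sup>2 * (w \<bullet> (G *v w))"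
      using inner_matrix_vector_mult_symmetric[OF sym, of w v]
      by (simp add: G_def matrix_vector_right_distrib matrix_vector_mult_scaleR inner_add_left
          inner_add_right power2_eq_square algebra_simps inner_commute)
    then show ?thesis
      unfolding lagr_def by (simp add: G_def inner_add_left inner_add_right algebra_simps)
  qed
  show ?thesis
    unfolding expand G_def by (auto intro!: derivative_eq_intros)
qed

lemma legendre_c_eq_iDstar_legendre:
  assumes sym: "transpose (g y) = g y"
  shows "legendre_c g eta V D (y, u) = iDstar g D (legendre g eta (y, u))"
proof -
  have "((\<lambda>t. lagr g eta V (y, u + t *\<^sub>R w)) has_real_derivative (a \<bullet> w)) (at 0) \<longleftrightarrow>
      (g y *v u + eta y - a) \<bullet> w = 0" for a w
  proof
    assume "((\<lambda>t. lagr g eta V (y, u + t *\<^sub>R w)) has_real_derivative (a \<bullet> w)) (at 0)"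
    then have "a \<bullet> w = (g y *v u + eta y) \<bullet> w"
      using DERIV_unique lagr_has_real_derivative_along_line[where g = g and q = y, OF sym] by blast
    then show "(g y *v u + eta y - a) \<bullet> w = 0"
      by (simp add: inner_diff_left)
  next
    assume "(g y *v u + eta y - a) \<bullet> w = 0"
    then have "a \<bullet> w = (g y *v u + eta y) \<bullet> w"
      by (simp add: inner_diff_left)
    then show "((\<lambda>t. lagr g eta V (y, u + t *\<^sub>R w)) has_real_derivative (a \<bullet> w)) (at 0)"
      using lagr_has_real_derivative_along_line[where g = g and q = y, OF sym] by simp
  qed
  then show ?thesis
    unfolding legendre_c_def iDstar_def legendre_def annih_def by simp
qed

lemma inj_on_legendre_c:
  assumes g: "riemannian_metric U g" and D: "\<And>y. y \<in> U \<Longrightarrow> subspace (D y)"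
  shows "inj_on (legendre_c g eta V D) (dbundle U D)"
proof (rule inj_onI)
  fix x x' assume "x \<in> dbundle U D" "x' \<in> dbundle U D"
    and eq: "legendre_c g eta V D x = legendre_c g eta V D x'"
  then obtain y u y' u' where x: "x = (y, u)" "y \<in> U" "u \<in> D y"
    and x': "x' = (y', u')" "y' \<in> U" "u' \<in> D y'"
    unfolding dbundle_def by blast
  have "legendre_c g eta V D (y, u) = iDstar g D (y, g y *v u + eta y)"
    "legendre_c g eta V D (y', u') = iDstar g D (y', g y' *v u' + eta y')"
    using legendre_c_eq_iDstar_legendre[where g = g and y = y, OF riemannian_metric_symmetric[OF g x(2)]]
      legendre_c_eq_iDstar_legendre[where g = g and y = y', OF riemannian_metric_symmetric[OF g x'(2)]]
    by (simp_all add: legendre_def)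
  moreover obtain a where a: "iDstar g D (y, g y *v u + eta y) = (y, a)"
    by (simp add: iDstar_def)
  ultimately have "y' = y" and a': "iDstar g D (y, g y *v u' + eta y) = (y, a)"
    using eq x x' by (auto simp: iDstar_def)
  have "g y *v u + eta y - a \<in> annih D y" "g y *v u' + eta y - a \<in> annih D y"
    using a a' iDstar_eq_iff[where D = D, OF g x(2) D[OF x(2)]] by blast+
  then have "(g y *v u + eta y - a) - (g y *v u' + eta y - a) \<in> annih D y"
    by (rule subspace_diff[OF subspace_annih])
  moreover have "u - u' \<in> D y"
    using subspace_diff[OF D[OF x(2)] x(3)] x'(3) \<open>y' = y\<close> by simp
  ultimately have "(u - u') \<bullet> (g y *v (u - u')) = 0"
    unfolding annih_def by (simp add: matrix_vector_mult_diff_distrib inner_commute)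
  then have "u = u'"
    using riemannian_metric_positive[OF g x(2), of "u - u'"] by force
  then show "x = x'"
    using x x' \<open>y' = y\<close> by simp
qed

lemma hamiltonian_c_iDstar_eq:
  assumes g: "riemannian_metric U g" and D: "\<And>y. y \<in> U \<Longrightarrow> subspace (D y)"
    and y: "y \<in> U" and c: "c \<in> D y" and "p - (g y *v c + eta y) \<in> annih D y"
  shows "(hamiltonian_c U g eta V D \<circ> iDstar g D) (y, p) = energy g V (y, c)"
proof -
  have "iDstar g D (y, p) = legendre_c g eta V D (y, c)"
    using iDstar_eq_if_annih[OF g y D[OF y] assms(5)]
      legendre_c_eq_iDstar_legendre[where g = g and y = y, OF riemannian_metric_symmetric[OF g y]]
    by (simp add: legendre_def)
  moreover have "(y, c) \<in> dbundle U D"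
    using y c by (simp add: dbundle_def)
  ultimately show ?thesis
    unfolding hamiltonian_c_def using the_inv_into_f_f[OF inj_on_legendre_c[OF g D]] by simp
qed

lemma inj_on_legendre:
  assumes g: "riemannian_metric U g"
  shows "inj_on (legendre g eta) (U \<times> UNIV)"
proof (rule inj_onI)
  fix x x' assume "x \<in> U \<times> UNIV" and "legendre g eta x = legendre g eta x'"
  then obtain y u u' where "x = (y, u)" "x' = (y, u')" "y \<in> U" "g y *v u = g y *v u'"
    by (cases x, cases x') (auto simp: legendre_def)
  then show "x = x'"
    using positive_definite_matrix_injective[OF riemannian_metric_positive[OF g]]
    by (simp add: inj_eq)
qed

lemma the_inv_into_legendre_eq:
  assumes g: "riemannian_metric U g" and "y \<in> U" and "g y *v b + eta y = p"
  shows "the_inv_into (U \<times> UNIV) (legendre g eta) (y, p) = (y, b)"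
  using assms by (intro the_inv_into_f_eq[OF inj_on_legendre[OF g]]) (simp_all add: legendre_def)

lemma the_inv_into_legendre:
  assumes g: "riemannian_metric U g" and y: "y \<in> U"
  obtains b where "the_inv_into (U \<times> UNIV) (legendre g eta) (y, p) = (y, b)"
    and "g y *v b + eta y = p"
proof -
  have "surj ((*v) (g y))"
    using positive_definite_matrix_injective[OF riemannian_metric_positive[OF g y]]
    by (intro linear_injective_imp_surjective) simp_all
  then obtain b where b: "g y *v b + eta y = p"
    by (metis diff_add_cancel surjD)
  with the_inv_into_legendre_eq[where eta = eta, OF g y b] show ?thesis
    by (rule that)
qed

lemma hamiltonian_eq:
  assumes "riemannian_metric U g" and "y \<in> U" and "g y *v b + eta y = p"
  shows "hamiltonian U g eta V (y, p) = energy g V (y, b)"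
  by (simp add: hamiltonian_def the_inv_into_legendre_eq[where eta = eta, OF assms])

lemma hamiltonian_gap_bounds:
  assumes g: "riemannian_metric U g" and D: "\<And>y. y \<in> U \<Longrightarrow> subspace (D y)"
    and y: "y \<in> U" and b: "g y *v b + eta y = p" and w: "w \<in> D y"
  shows "0 \<le> hamiltonian U g eta V (y, p) - (hamiltonian_c U g eta V D \<circ> iDstar g D) (y, p)"
    and "hamiltonian U g eta V (y, p) - (hamiltonian_c U g eta V D \<circ> iDstar g D) (y, p)
           \<le> (1/2) * ((b - w) \<bullet> (g y *v (b - w)))"
proof -
  obtain c where c: "c \<in> D y" and orth: "\<forall>x\<in>D y. (g y *v (b - c)) \<bullet> x = 0"
    using exists_orthogonal_projection[OF riemannian_metric_positive[OF g y] D[OF y]] .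
  have "p - (g y *v c + eta y) \<in> annih D y"
    using orth unfolding b[symmetric] annih_def by (simp add: matrix_vector_mult_diff_distrib)
  then have "hamiltonian U g eta V (y, p) - (hamiltonian_c U g eta V D \<circ> iDstar g D) (y, p)
      = (1/2) * (b \<bullet> (g y *v b) - c \<bullet> (g y *v c))"
    using hamiltonian_eq[where g = g and eta = eta and y = y, OF g y b]
      hamiltonian_c_iDstar_eq[where D = D, OF g D y c]
    by (simp add: energy_def algebra_simps)
  then show "0 \<le> hamiltonian U g eta V (y, p) - (hamiltonian_c U g eta V D \<circ> iDstar g D) (y, p)"
    and "hamiltonian U g eta V (y, p) - (hamiltonian_c U g eta V D \<circ> iDstar g D) (y, p)
           \<le> (1/2) * ((b - w) \<bullet> (g y *v (b - w)))"
    using orthogonal_projection_quadratic_form_bounds[OF riemannian_metric_symmetric[OF g y]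
        riemannian_metric_nonneg[OF g y] D[OF y] c w orth]
    by simp_all
qed

lemma smooth_on_imp_continuous_on: "smooth_on S f \<Longrightarrow> continuous_on S f"
  unfolding smooth_on_def by (metis Ck_on.simps(1))

lemma smooth_on_imp_differentiable: "smooth_on S f \<Longrightarrow> x \<in> S \<Longrightarrow> f differentiable (at x)"
  unfolding smooth_on_def by (metis Ck_on.simps(2))

lemma has_derivative_compose_fst:
  assumes "(f has_derivative f') (at (fst z))"
  shows "((\<lambda>x. f (fst x)) has_derivative (\<lambda>h. f' (fst h))) (at z)"
  using diff_chain_at[OF has_derivative_fst[OF has_derivative_ident] assms] by (simp add: o_def)

lemma has_derivative_matrix_vector_mult_fst:
  fixes M :: "'a::real_normed_vector \<Rightarrow> real^'n^'m"
  assumes "(M has_derivative M') (at y)"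
  shows "((\<lambda>x. M (fst x) *v snd x) has_derivative (\<lambda>h. M y *v snd h + M' (fst h) *v v)) (at (y, v))"
proof -
  have "(M has_derivative M') (at (fst (y, v)))"
    using assms by simp
  from bounded_bilinear.FDERIV[OF bounded_bilinear_matrix_vector_mult
      has_derivative_compose_fst[OF this] has_derivative_snd[OF has_derivative_ident]]
  show ?thesis
    by simp
qed

lemma the_inv_into_legendre_differentiable:
  assumes U: "open U" and g: "riemannian_metric U g" and eta: "smooth_on U eta" and q: "q \<in> U"
  shows "the_inv_into (U \<times> UNIV) (legendre g eta) differentiable (at (legendre g eta (q, v)))"
proof -
  have g_smooth: "smooth_on U g"
    using riemannian_metric_smooth[OF g] .
  obtain g' eta' where g': "(g has_derivative g') (at q)" and eta': "(eta has_derivative eta') (at q)"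
    using smooth_on_imp_differentiable[OF g_smooth q] smooth_on_imp_differentiable[OF eta q]
    unfolding differentiable_def by blast
  have legendre: "legendre g eta = (\<lambda>x. (fst x, g (fst x) *v snd x + eta (fst x)))"
    by (auto simp: legendre_def)
  have "continuous_on (U \<times> UNIV) (\<lambda>x. g (fst x))" "continuous_on (U \<times> UNIV) (\<lambda>x. eta (fst x))"
    using smooth_on_imp_continuous_on[OF g_smooth] smooth_on_imp_continuous_on[OF eta]
    by (auto intro: continuous_on_compose2[OF _ continuous_on_fst[OF continuous_on_id]])
  then have cont: "continuous_on (U \<times> UNIV) (legendre g eta)"
    unfolding legendre
    by (intro continuous_on_Pair continuous_on_add continuous_on_fst continuous_on_snd continuous_on_id
        bounded_bilinear.continuous_on[OF bounded_bilinear_matrix_vector_mult])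
  have inverse: "the_inv_into (U \<times> UNIV) (legendre g eta) (legendre g eta x) = x"
    if "x \<in> U \<times> UNIV" for x
    using the_inv_into_f_f[OF inj_on_legendre[OF g] that] .
  have deriv: "(legendre g eta has_derivative
      (\<lambda>h. (fst h, g q *v snd h + g' (fst h) *v v + eta' (fst h)))) (at (q, v))"
    unfolding legendre
    by (intro has_derivative_Pair has_derivative_add has_derivative_matrix_vector_mult_fst[OF g']
        has_derivative_compose_fst has_derivative_fst has_derivative_ident) (simp add: eta')
  obtain B where B: "g q ** B = mat 1"
    using positive_definite_matrix_injective[OF riemannian_metric_positive[OF g q]]
      matrix_left_invertible_injective matrix_left_right_inverse by blast
  then have deriv_inverse: "(\<lambda>h. (fst h, g q *v snd h + g' (fst h) *v v + eta' (fst h))) \<circ>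
      (\<lambda>h. (fst h, B *v (snd h - g' (fst h) *v v - eta' (fst h)))) = id"
    by (auto simp: matrix_vector_mul_assoc)
  show ?thesis
    unfolding differentiable_def
    using has_derivative_inverse_strong[OF open_Times[OF U open_UNIV] _ cont inverse deriv deriv_inverse] q
    by blast
qed

lemma energy_differentiable:
  assumes "g differentiable (at q)" and "V differentiable (at q)"
  shows "energy g V differentiable (at (q, v))"
proof -
  obtain g' V' where g': "(g has_derivative g') (at q)" and V': "(V has_derivative V') (at q)"
    using assms unfolding differentiable_def by blast
  have energy: "energy g V = (\<lambda>x. (1/2) * (snd x \<bullet> (g (fst x) *v snd x)) + V (fst x))"
    by (auto simp: energy_def)
  have V_fst: "((\<lambda>x. V (fst x)) has_derivative (\<lambda>h. V' (fst h))) (at (q, v))"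
    using has_derivative_compose_fst[of V V' "(q, v)"] V' by simp
  have "(energy g V has_derivative
      (\<lambda>h. (1/2) * (v \<bullet> (g q *v snd h + g' (fst h) *v v) + snd h \<bullet> (g q *v v)) + V' (fst h)))
      (at (q, v))"
    unfolding energy
    using has_derivative_add[OF has_derivative_mult_right[where x = "1/2", OF has_derivative_inner[OF
          has_derivative_snd[OF has_derivative_ident] has_derivative_matrix_vector_mult_fst[OF g']]] V_fst]
    by simp
  then show ?thesis
    unfolding differentiable_def by blast
qed

lemma has_derivative_quadratic_form_vanishing:
  fixes e :: "'a::real_normed_vector \<Rightarrow> real^'n" and M :: "'a \<Rightarrow> real^'n^'n"
  assumes e: "(e has_derivative e') (at x)" and "e x = 0" and M: "(M has_derivative M') (at x)"
  shows "((\<lambda>z. e z \<bullet> (M z *v e z)) has_derivative (\<lambda>_. 0)) (at x)"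
proof -
  have "((\<lambda>z. e z \<bullet> (M z *v e z)) has_derivative
      (\<lambda>h. e x \<bullet> (M x *v e' h + M' h *v e x) + e' h \<bullet> (M x *v e x))) (at x)"
    using has_derivative_inner[OF e bounded_bilinear.FDERIV[OF bounded_bilinear_matrix_vector_mult M e]]
    by simp
  then show ?thesis
    using \<open>e x = 0\<close> by simp
qed

lemma has_derivative_zero_squeeze:
  fixes f \<phi> :: "'a::real_normed_vector \<Rightarrow> real"
  assumes bounds: "\<forall>\<^sub>F y in nhds x. 0 \<le> f y \<and> f y \<le> \<phi> y"
    and \<phi>x: "\<phi> x = 0" and \<phi>: "(\<phi> has_derivative (\<lambda>_. 0)) (at x)"
  shows "(f has_derivative (\<lambda>_. 0)) (at x)"
proof -
  have fx: "f x = 0"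
    using eventually_nhds_x_imp_x[OF bounds] \<phi>x by simp
  have quotient_bound: "norm (norm (f y) / norm (y - x)) \<le> norm (\<phi> y) / norm (y - x)"
    if "0 \<le> f y \<and> f y \<le> \<phi> y" for y
    using that by (simp add: divide_right_mono)
  have "\<forall>\<^sub>F y in nhds x. norm (norm (f y) / norm (y - x)) \<le> norm (\<phi> y) / norm (y - x)"
    by (rule eventually_mono[OF bounds quotient_bound])
  then have "\<forall>\<^sub>F y in at x. norm (norm (f y) / norm (y - x)) \<le> norm (\<phi> y) / norm (y - x)"
    unfolding eventually_at_filter by (rule eventually_mono) simp
  moreover have "((\<lambda>y. norm (\<phi> y) / norm (y - x)) \<longlongrightarrow> 0) (at x)"
    using \<phi> \<phi>x unfolding has_derivative_iff_norm by simp
  ultimately have "((\<lambda>y. norm (f y) / norm (y - x)) \<longlongrightarrow> 0) (at x)"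
    by (rule Lim_null_comparison)
  then show ?thesis
    unfolding has_derivative_iff_norm using fx by simp
qed

lemma span_image_sum:
  fixes f :: "nat \<Rightarrow> 'a::real_vector"
  assumes "x \<in> span (f ` {..<r})"
  obtains c where "x = (\<Sum>i<r. c i *\<^sub>R f i)"
proof -
  from assms have "\<exists>c. x = (\<Sum>i<r. c i *\<^sub>R f i)"
  proof (induction rule: span_induct_alt)
    case base
    show ?case
      by (rule exI[of _ "\<lambda>_. 0"]) simp
  next
    case (step a x y)
    then obtain c j where c: "y = (\<Sum>i<r. c i *\<^sub>R f i)" and j: "j < r" "x = f j"
      by blast
    have "(\<Sum>i<r. (if i = j then a else 0) *\<^sub>R f i) = (\<Sum>i<r. if i = j then a *\<^sub>R f j else 0)"
      by (intro sum.cong) auto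
    then have "(\<Sum>i<r. (c i + (if i = j then a else 0)) *\<^sub>R f i) = y + a *\<^sub>R x"
      using j c by (simp add: scaleR_add_left sum.distrib)
    then show ?case
      by (metis add.commute)
  qed
  then show ?thesis
    using that by blast
qed

lemma smooth_distribution_local_section:
  assumes "smooth_distribution U D r" and "q \<in> U" and "v \<in> D q"
  obtains W w where "open W" "q \<in> W" "W \<subseteq> U" "\<And>y. y \<in> W \<Longrightarrow> w y \<in> D y"
    and "w q = v" and "w differentiable (at q)"
proof -
  obtain W X where W: "open W" "q \<in> W" "W \<subseteq> U"
    and X: "\<And>i. i < r \<Longrightarrow> smooth_on W (X i)"
    and span: "\<And>y. y \<in> W \<Longrightarrow> D y = span ((\<lambda>i. X i y) ` {..<r})"
    using assms(1,2) unfolding smooth_distribution_def by metis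
  obtain c where c: "v = (\<Sum>i<r. c i *\<^sub>R X i q)"
    using span_image_sum[of v "\<lambda>i. X i q" r] assms(3) span[OF W(2)] by blast
  define w where "w y = (\<Sum>i<r. c i *\<^sub>R X i y)" for y
  show ?thesis
  proof (rule that[OF W, of w])
    show "w y \<in> D y" if "y \<in> W" for y
      unfolding span[OF that] w_def by (intro span_sum span_scale span_base) auto
    show "w q = v"
      using c by (simp add: w_def)
    show "w differentiable (at q)"
      unfolding w_def[abs_def] using smooth_on_imp_differentiable[OF X W(2)]
      by (intro differentiable_sum ballI differentiable_scaleR differentiable_const) auto
  qed
qed

lemma hamiltonian_differentiable:
  assumes U: "open U" and g: "riemannian_metric U g" and eta: "smooth_on U eta"
    and V: "smooth_on U V" and q: "q \<in> U"
  shows "hamiltonian U g eta V differentiable (at (legendre g eta (q, v)))"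
proof -
  have "the_inv_into (U \<times> UNIV) (legendre g eta) (legendre g eta (q, v)) = (q, v)"
    using the_inv_into_f_f[OF inj_on_legendre[OF g]] q by simp
  then have "energy g V differentiable
      (at (the_inv_into (U \<times> UNIV) (legendre g eta) (legendre g eta (q, v))))"
    using energy_differentiable[OF smooth_on_imp_differentiable[OF riemannian_metric_smooth[OF g] q]
        smooth_on_imp_differentiable[OF V q]]
    by simp
  then show ?thesis
    unfolding hamiltonian_def
    by (rule differentiable_chain_at[OF the_inv_into_legendre_differentiable[OF U g eta q]])
qed

lemma hamiltonian_gap_eventually_bounds:
  fixes z\<^sub>0 :: "(real^'n) \<times> (real^'n)"
  assumes g: "riemannian_metric U g" and D: "\<And>y. y \<in> U \<Longrightarrow> subspace (D y)"
    and W: "open W" "W \<subseteq> U" "fst z\<^sub>0 \<in> W" and w: "\<And>y. y \<in> W \<Longrightarrow> w y \<in> D y"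
  shows "\<forall>\<^sub>F z in nhds z\<^sub>0.
      0 \<le> hamiltonian U g eta V z - (hamiltonian_c U g eta V D \<circ> iDstar g D) z \<and>
      hamiltonian U g eta V z - (hamiltonian_c U g eta V D \<circ> iDstar g D) z
        \<le> (1/2) * ((snd (the_inv_into (U \<times> UNIV) (legendre g eta) z) - w (fst z)) \<bullet>
                    (g (fst z) *v (snd (the_inv_into (U \<times> UNIV) (legendre g eta) z) - w (fst z))))"
    (is "\<forall>\<^sub>F z in nhds z\<^sub>0. ?bounds z")
proof -
  have "\<forall>\<^sub>F z in nhds z\<^sub>0. z \<in> W \<times> UNIV"
    using W by (intro eventually_nhds_in_open) (auto simp: open_Times mem_Times_iff)
  then show ?thesis
  proof (rule eventually_mono)
    fix z :: "(real^'n) \<times> (real^'n)" assume "z \<in> W \<times> UNIV"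
    then obtain y p where z: "z = (y, p)" and y: "y \<in> W"
      by blast
    then have y_U: "y \<in> U"
      using W(2) by blast
    obtain b where "the_inv_into (U \<times> UNIV) (legendre g eta) (y, p) = (y, b)"
      and b: "g y *v b + eta y = p"
      using the_inv_into_legendre[where eta = eta and p = p, OF g y_U] by blast
    then show "?bounds z"
      using hamiltonian_gap_bounds[where V = V and D = D and eta = eta and y = y,
          OF g D y_U b w[OF y]] z
      by simp
  qed
qed

lemma hamiltonian_gap_has_derivative_zero:
  assumes U: "open U" and g: "riemannian_metric U g" and eta: "smooth_on U eta"
    and D: "smooth_distribution U D r" and q: "q \<in> U" and v: "v \<in> D q"
  shows "((\<lambda>z. hamiltonian U g eta V z - (hamiltonian_c U g eta V D \<circ> iDstar g D) z)
           has_derivative (\<lambda>_. 0)) (at (legendre g eta (q, v)))"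
proof -
  define \<beta> where "\<beta> = legendre g eta (q, v)"
  define \<Psi> where "\<Psi> = the_inv_into (U \<times> UNIV) (legendre g eta)"
  have fst_\<beta>: "fst \<beta> = q"
    by (simp add: \<beta>_def legendre_def)
  have \<Psi>_\<beta>: "\<Psi> \<beta> = (q, v)"
    unfolding \<Psi>_def \<beta>_def using the_inv_into_f_f[OF inj_on_legendre[OF g]] q by simp
  obtain \<Psi>' where \<Psi>': "(\<Psi> has_derivative \<Psi>') (at \<beta>)"
    using the_inv_into_legendre_differentiable[OF U g eta q]
    unfolding \<Psi>_def \<beta>_def differentiable_def by blast
  obtain g' where g': "(g has_derivative g') (at (fst \<beta>))"
    using smooth_on_imp_differentiable[OF riemannian_metric_smooth[OF g] q]
    unfolding fst_\<beta> differentiable_def by blast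
  obtain W w w' where W: "open W" "q \<in> W" "W \<subseteq> U" and w_D: "\<And>y. y \<in> W \<Longrightarrow> w y \<in> D y"
    and "w q = v" and w': "(w has_derivative w') (at (fst \<beta>))"
    using smooth_distribution_local_section[OF D q v] unfolding fst_\<beta> differentiable_def by metis
  define e where "e z = snd (\<Psi> z) - w (fst z)" for z
  have "((\<lambda>z. e z \<bullet> (g (fst z) *v e z)) has_derivative (\<lambda>_. 0)) (at \<beta>)"
  proof (rule has_derivative_quadratic_form_vanishing)
    show "(e has_derivative (\<lambda>h. snd (\<Psi>' h) - w' (fst h))) (at \<beta>)"
      unfolding e_def[abs_def]
      by (intro has_derivative_diff has_derivative_snd \<Psi>' has_derivative_compose_fst w')
    show "e \<beta> = 0"
      using \<Psi>_\<beta> \<open>w q = v\<close> fst_\<beta> by (simp add: e_def)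
  qed (rule has_derivative_compose_fst[OF g'])
  then have bound_deriv: "((\<lambda>z. (1/2) * (e z \<bullet> (g (fst z) *v e z))) has_derivative (\<lambda>_. 0)) (at \<beta>)"
    using has_derivative_mult_right[where x = "1/2"] by fastforce
  have D_subspace: "\<And>y. y \<in> U \<Longrightarrow> subspace (D y)"
    using D unfolding smooth_distribution_def by blast
  have "\<forall>\<^sub>F z in nhds \<beta>.
      0 \<le> hamiltonian U g eta V z - (hamiltonian_c U g eta V D \<circ> iDstar g D) z \<and>
      hamiltonian U g eta V z - (hamiltonian_c U g eta V D \<circ> iDstar g D) z
        \<le> (1/2) * (e z \<bullet> (g (fst z) *v e z))"
    unfolding e_def \<Psi>_def
    by (rule hamiltonian_gap_eventually_bounds[OF g D_subspace W(1,3)]) (use W(2) fst_\<beta> w_D in auto)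
  then show ?thesis
    unfolding \<beta>_def[symmetric]
    by (rule has_derivative_zero_squeeze[OF _ _ bound_deriv]) (simp add: e_def \<Psi>_\<beta> \<open>w q = v\<close> fst_\<beta>)
qed

theorem lemma3p3:
  fixes U :: "(real^'n) set"
    and g :: "real^'n \<Rightarrow> real^'n^'n"
    and eta :: "real^'n \<Rightarrow> real^'n"
    and V :: "real^'n \<Rightarrow> real"
    and D :: "real^'n \<Rightarrow> (real^'n) set"
    and r :: nat
    and q v :: "real^'n"
  assumes "open U"
    and "riemannian_metric U g"
    and "smooth_on U eta"
    and "smooth_on U V"
    and "smooth_distribution U D r"
    and "r \<ge> 2"
    and "q \<in> U"
    and "v \<in> D q"
  shows "\<exists>dH. (hamiltonian U g eta V has_derivative dH) (at (legendre g eta (q, v))) \<and>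
               ((hamiltonian_c U g eta V D \<circ> iDstar g D) has_derivative dH) (at (legendre g eta (q, v)))"
proof -
  obtain dH where dH: "(hamiltonian U g eta V has_derivative dH) (at (legendre g eta (q, v)))"
    using hamiltonian_differentiable[OF assms(1-4,7)] unfolding differentiable_def by blast
  moreover have "((hamiltonian_c U g eta V D \<circ> iDstar g D) has_derivative dH) (at (legendre g eta (q, v)))"
    using has_derivative_diff[OF dH hamiltonian_gap_has_derivative_zero[where V = V, OF assms(1-3,5,7,8)]]
    by (simp add: o_def)
  ultimately show ?thesis
    by blast
qed

end
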